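(* Let $\tau_T:S(V)\to\mathbb{C}$ be the linear map given by the interaction vertices, and let $\sigma_T^k:=\tau_T^{\otimes k}\circ\Lambda^{k-1}:S(V)\to\mathbb C$ for $k\ge1$. Then $\sigma_T^k$ is determined recursively by $\sigma_T^1=\tau_T$ and, for $k>1$, $$\sigma_T^{k}=\frac{1}{k-1}\sum_{i=1}^{k-1}(\sigma_T^i\otimes\sigma_T^{k-i})\circ Q .$$
   Context: $V$ is the complex vector space of finite linear combinations of field operators $\phi(x)$, $x$ ranging over a set of labels (purely bosonic case). $S(V)=\bigoplus_{k\ge0}V^k$ is the (commutative) symmetric algebra over $V$ with unit $\mathbf 1$. The coproduct $\Delta:S(V)\to S(V)\otimes S(V)$ is the algebra homomorphism with $\Delta(\mathbf 1)=\mathbf 1\otimes\mathbf 1$, $\Delta(\phi(x))=\phi(x)\otimes\mathbf 1+\mathbf 1\otimes\phi(x)$. $G_F(x,y)=G_F(y,x)$ is the Feynman propagator, with inverse $G_F^{-1}$ determined by $\int dy\,G_F(x,y)G_F^{-1}(y,z)=\delta(x,z)$ ($\int dx$ denotes integration/summation over labels and is used formally: linear forms are evaluated under the integral sign). Put $R:=\int dx\,dy\,G_F^{-1}(x,y)\,(\phi(x)\otimes\phi(y))$, a formal (symmetric) element of (a completion of) $S(V)\otimes S(V)$, also viewed as the operator of multiplication by $R$. Put $Q:=\frac12 R\circ\Delta:S(V)\to S(V)\otimes S(V)$ and $Q_i:=\mathrm{id}^{\otimes i-1}\otimes Q\otimes\mathrm{id}^{\otimes k-i}:S(V)^{\otimes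 k}\to S(V)^{\otimes k+1}$. Maps $\Lambda^k:S(V)\to S(V)^{\otimes k+1}$ are defined by $\Lambda^0:=\mathrm{id}$ and $\Lambda^k:=\frac1k\sum_{i=1}^kQ_i\circ\Lambda^{k-1}$ for $k\ge1$. $\tau_T(\phi(x_1)\cdots\phi(x_n))$ is the tree level contribution to the 1PI $n$-point function, i.e. the $n$-point interaction vertex of the Lagrangian (with propagators $G_F$ on its legs); it vanishes on $V^0$, $V^1$ and $V^2$. *)

theory Defs
  imports Complex_Main "HOL-Library.Multiset" "HOL-Library.Poly_Mapping" "HOL-Library.Product_Plus"
begin

section \<open>The symmetric algebra and its tensor powers\<close>

text \<open>
  \<open>V\<close> has the basis \<open>\<phi>(x)\<close>, with \<open>x\<close> ranging over the type \<open>'x\<close> of labels, so \<open>S(V)\<close> has the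
  monomials \<open>\<phi>(x\<^sub>1)\<cdots>\<phi>(x\<^sub>n)\<close>, i.e. the finite multisets of labels, as a basis.  Multiplication of
  \<open>poly_mapping\<close>s is convolution, which is multiplication in \<open>S(V)\<close>, and (the exponents being added
  componentwise) the factorwise multiplication \<open>(a \<otimes> b)(c \<otimes> d) = ac \<otimes> bd\<close> in \<open>S(V) \<otimes> S(V)\<close>.
\<close>

type_synonym 'x symalg = "'x multiset \<Rightarrow>\<^sub>0 complex"
type_synonym 'x symalg2 = "('x multiset \<times> 'x multiset) \<Rightarrow>\<^sub>0 complex"

text \<open>
  All tensor powers at once: \<open>S(V)\<^bsup>\<otimes>k\<^esup>\<close> is spanned by the lists of length \<open>k\<close>, where \<open>[m\<^sub>1,\<dots>,m\<^sub>k]\<close>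
  stands for \<open>m\<^sub>1 \<otimes> \<cdots> \<otimes> m\<^sub>k\<close>.
\<close>

type_synonym 'x tensors = "'x multiset list \<Rightarrow>\<^sub>0 complex"

definition scale :: "complex \<Rightarrow> ('b \<Rightarrow>\<^sub>0 complex) \<Rightarrow> ('b \<Rightarrow>\<^sub>0 complex)" where
  "scale c p = Poly_Mapping.map ((*) c) p"

definition basis :: "'b \<Rightarrow> ('b \<Rightarrow>\<^sub>0 complex)" where
  "basis b = Poly_Mapping.single b 1"

definition linear_ext :: "('b \<Rightarrow> ('c \<Rightarrow>\<^sub>0 complex)) \<Rightarrow> ('b \<Rightarrow>\<^sub>0 complex) \<Rightarrow> ('c \<Rightarrow>\<^sub>0 complex)" where
  "linear_ext g p = (\<Sum>b\<in>Poly_Mapping.keys p. scale (Poly_Mapping.lookup p b) (g b))"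

definition linear_form :: "('b \<Rightarrow> complex) \<Rightarrow> ('b \<Rightarrow>\<^sub>0 complex) \<Rightarrow> complex" where
  "linear_form g p = (\<Sum>b\<in>Poly_Mapping.keys p. Poly_Mapping.lookup p b * g b)"

definition field_op :: "'x \<Rightarrow> 'x symalg" where
  "field_op x = basis {#x#}"

definition tensor :: "'x symalg \<Rightarrow> 'x symalg \<Rightarrow> 'x symalg2" where
  "tensor u v = linear_ext (\<lambda>a. linear_ext (\<lambda>b. basis (a, b)) v) u"

definition coproduct :: "'x symalg \<Rightarrow> 'x symalg2" where
  "coproduct = linear_ext (\<lambda>m. \<Prod>x\<in>#m. tensor (field_op x) 1 + tensor 1 (field_op x))"

text \<open>The form \<open>f\<^sub>1 \<otimes> \<cdots> \<otimes> f\<^sub>k\<close> on \<open>S(V)\<^bsup>\<otimes>k\<^esup>\<close>, for linear forms \<open>f\<^sub>1,\<dots>,f\<^sub>k\<close> on \<open>S(V)\<close>.\<close>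

definition tensor_form :: "('x symalg \<Rightarrow> complex) list \<Rightarrow> 'x tensors \<Rightarrow> complex" where
  "tensor_form fs = linear_form (\<lambda>ms.
     if length ms = length fs then prod_list (map2 (\<lambda>f m. f (basis m)) fs ms) else 0)"

section \<open>The inverse propagator\<close>

text \<open>
  The inverse \<open>G\<^sub>F\<^sup>-\<^sup>1\<close> is in general a distribution (as is \<open>\<delta>\<close>) and not a function.  It is
  represented by its formal pairing \<open>f \<mapsto> \<integral>dx dy G\<^sub>F\<^sup>-\<^sup>1(x,y) f(x,y)\<close>, of which nothing but linearity is
  used to integrate.  Being formal, it has no domain of convergence: an actual sum or integral, defined
  on a subspace of functions only, is to be extended linearly to all functions.

  The equation \<open>\<integral>dy G\<^sub>F(x,y) G\<^sub>F\<^sup>-\<^sup>1(y,z) = \<delta>(x,z)\<close> is read as an equation of generalized functions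
  of \<open>z\<close>, i.e. integrated against a function \<open>h(z)\<close>.
\<close>

definition formal_integral :: "(('i \<Rightarrow> complex) \<Rightarrow> complex) \<Rightarrow> bool" where
  "formal_integral J \<longleftrightarrow>
     (\<forall>f g. J (\<lambda>p. f p + g p) = J f + J g) \<and> (\<forall>c f. J (\<lambda>p. c * f p) = c * J f)"

definition inverse_propagator ::
    "('x \<Rightarrow> 'x \<Rightarrow> complex) \<Rightarrow> (('x \<times> 'x \<Rightarrow> complex) \<Rightarrow> complex) \<Rightarrow> bool" where
  "inverse_propagator GF Ginv \<longleftrightarrow>
     formal_integral Ginv \<and>
     (\<forall>f. Ginv (\<lambda>(x, y). f (y, x)) = Ginv f) \<and>
     (\<forall>x h. Ginv (\<lambda>(y, z). GF x y * h z) = h x)"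

section \<open>The maps \<open>Q\<close> and \<open>\<Lambda>\<^sup>k\<close>\<close>

text \<open>
  An element \<open>\<integral>dx\<^sub>1 dy\<^sub>1 \<cdots> dx\<^sub>n dy\<^sub>n G\<^sub>F\<^sup>-\<^sup>1(x\<^sub>1,y\<^sub>1) \<cdots> G\<^sub>F\<^sup>-\<^sup>1(x\<^sub>n,y\<^sub>n) T(x\<^sub>1,y\<^sub>1,\<dots>,x\<^sub>n,y\<^sub>n)\<close> of the completion
  is represented by its integrand \<open>T\<close>, with values in the tensor power.  In this way
  \<open>R\<close> is \<open>(x,y) \<mapsto> \<phi>(x) \<otimes> \<phi>(y)\<close>, each application of \<open>Q\<close> introduces one new pair of
  integration variables, and \<open>\<Lambda>\<^sup>k s\<close> is the integral over \<open>k\<close> pairs, given below by their list.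
  A linear form is evaluated on the integrand, under the integral signs.
\<close>

fun iterated_integral ::
    "(('i \<Rightarrow> complex) \<Rightarrow> complex) \<Rightarrow> nat \<Rightarrow> ('i list \<Rightarrow> complex) \<Rightarrow> complex" where
  "iterated_integral J 0 f = f []"
| "iterated_integral J (Suc n) f = J (\<lambda>p. iterated_integral J n (\<lambda>ps. f (p # ps)))"

definition R_integrand :: "'x \<times> 'x \<Rightarrow> 'x symalg2" where
  "R_integrand p = tensor (field_op (fst p)) (field_op (snd p))"

definition Q :: "'x \<times> 'x \<Rightarrow> 'x symalg \<Rightarrow> 'x tensors" where
  "Q p s = linear_ext (\<lambda>(a, b). basis [a, b]) (scale (1/2) (R_integrand p * coproduct s))"

text \<open>\<open>Q_at i\<close> is \<open>Q\<^sub>i = id\<^bsup>\<otimes>i-1\<^esup> \<otimes> Q \<otimes> id\<^bsup>\<otimes>k-i\<^esup>\<close>, where \<open>1 \<le> i \<le> k\<close>.\<close>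

definition Q_at :: "nat \<Rightarrow> 'x \<times> 'x \<Rightarrow> 'x tensors \<Rightarrow> 'x tensors" where
  "Q_at i p = linear_ext (\<lambda>ms.
     linear_ext (\<lambda>ns. basis (take (i - 1) ms @ ns @ drop i ms)) (Q p (basis (ms ! (i - 1)))))"

text \<open>The last pair of variables belongs to the last application of a \<open>Q\<^sub>i\<close>.\<close>

fun Lambda :: "nat \<Rightarrow> ('x \<times> 'x) list \<Rightarrow> 'x symalg \<Rightarrow> 'x tensors" where
  "Lambda 0 ps s = linear_ext (\<lambda>m. basis [m]) s"
| "Lambda (Suc k) ps s =
     scale (1 / of_nat (Suc k)) (\<Sum>i=1..Suc k. Q_at i (ps ! k) (Lambda k (take k ps) s))"

section \<open>Vertices and the forms \<open>\<sigma>\<^sub>T\<^sup>k\<close>\<close>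

text \<open>
  \<open>vert {#h\<^sub>1,\<dots>,h\<^sub>n#}\<close> is the (symmetric, multilinear) \<open>n\<close>-point interaction vertex of the
  Lagrangian, integrated against \<open>h\<^sub>1(y\<^sub>1)\<cdots>h\<^sub>n(y\<^sub>n)\<close>.
\<close>

definition interaction_vertices :: "(('x \<Rightarrow> complex) multiset \<Rightarrow> complex) \<Rightarrow> bool" where
  "interaction_vertices vert \<longleftrightarrow>
     (\<forall>H. size H \<le> 2 \<longrightarrow> vert H = 0) \<and>
     (\<forall>H h h' a b. vert (add_mset (\<lambda>y. a * h y + b * h' y) H) =
        a * vert (add_mset h H) + b * vert (add_mset h' H))"

definition tau_T ::
    "('x \<Rightarrow> 'x \<Rightarrow> complex) \<Rightarrow> (('x \<Rightarrow> complex) multiset \<Rightarrow> complex) \<Rightarrow> 'x symalg \<Rightarrow> complex" where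
  "tau_T GF vert = linear_form (\<lambda>m. vert (image_mset GF m))"

definition comp_Q ::
    "(('x \<times> 'x \<Rightarrow> complex) \<Rightarrow> complex) \<Rightarrow> ('x tensors \<Rightarrow> complex) \<Rightarrow> 'x symalg \<Rightarrow> complex" where
  "comp_Q Ginv F s = Ginv (\<lambda>p. F (Q p s))"

definition comp_Lambda ::
    "(('x \<times> 'x \<Rightarrow> complex) \<Rightarrow> complex) \<Rightarrow> ('x tensors \<Rightarrow> complex) \<Rightarrow> nat \<Rightarrow> 'x symalg \<Rightarrow> complex" where
  "comp_Lambda Ginv F k s = iterated_integral Ginv k (\<lambda>ps. F (Lambda k ps s))"

definition sigma_T ::
    "(('x \<times> 'x \<Rightarrow> complex) \<Rightarrow> complex) \<Rightarrow> ('x symalg \<Rightarrow> complex) \<Rightarrow> nat \<Rightarrow> 'x symalg \<Rightarrow> complex" where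
  "sigma_T Ginv \<tau> k = comp_Lambda Ginv (tensor_form (replicate k \<tau>)) (k - 1)"

section \<open>The coproduct is an algebra homomorphism\<close>

lemma scale_conv_mult: "scale c p = Poly_Mapping.single 0 c * (p :: 'b::monoid_add \<Rightarrow>\<^sub>0 complex)"
  by (simp add: scale_def mult_map_scale_conv_mult)

lemma linear_ext_superset:
  assumes "finite A" "Poly_Mapping.keys p \<subseteq> A"
  shows "linear_ext g p = (\<Sum>b\<in>A. scale (Poly_Mapping.lookup p b) (g b))"
  unfolding linear_ext_def using assms
  by (intro sum.mono_neutral_left)
     (auto simp: in_keys_iff scale_def map_eq_zero_iff)

lemma scale_add_left: "scale (c + d) p = scale c p + scale d p"
  by (rule poly_mapping_eqI) (simp add: scale_def lookup_add map.rep_eq when_def algebra_simps)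

lemma scale_scale: "scale c (scale d p) = scale (c * d) p"
  by (rule poly_mapping_eqI) (simp add: scale_def map.rep_eq when_def)

lemma linear_ext_add: "linear_ext g (p + q) = linear_ext g p + linear_ext g q"
proof -
  let ?A = "Poly_Mapping.keys p \<union> Poly_Mapping.keys q"
  have "linear_ext g (p + q) = (\<Sum>b\<in>?A. scale (Poly_Mapping.lookup (p + q) b) (g b))"
    by (intro linear_ext_superset) (auto simp: keys_add)
  also have "\<dots> = linear_ext g p + linear_ext g q"
    by (simp add: linear_ext_superset[of ?A] lookup_add scale_add_left sum.distrib)
  finally show ?thesis .
qed

lemma linear_ext_0 [simp]: "linear_ext g 0 = 0"
  by (simp add: linear_ext_def)

lemma linear_ext_sum: "linear_ext g (sum f A) = (\<Sum>a\<in>A. linear_ext g (f a))"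
  by (induction A rule: infinite_finite_induct) (simp_all add: linear_ext_add)

lemma linear_ext_single: "linear_ext g (Poly_Mapping.single b c) = scale c (g b)"
  by (simp add: linear_ext_superset[of "{b}"])

lemma poly_mapping_as_sum:
  "p = (\<Sum>b\<in>Poly_Mapping.keys p. Poly_Mapping.single b (Poly_Mapping.lookup p b))"
proof (rule poly_mapping_eqI)
  fix k
  show "Poly_Mapping.lookup p k = Poly_Mapping.lookup
      (\<Sum>b\<in>Poly_Mapping.keys p. Poly_Mapping.single b (Poly_Mapping.lookup p b)) k"
    by (cases "k \<in> Poly_Mapping.keys p")
       (auto simp: lookup_sum lookup_single when_def in_keys_iff)
qed

lemma coproduct_mult: "coproduct (p * q) = coproduct p * coproduct q"
proof -
  define g :: "'a multiset \<Rightarrow> 'a symalg2" where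
    "g = (\<lambda>m. \<Prod>x\<in>#m. tensor (field_op x) 1 + tensor 1 (field_op x))"
  have cop: "coproduct = linear_ext g"
    by (simp add: coproduct_def g_def)
  let ?l = Poly_Mapping.lookup and ?k = Poly_Mapping.keys
  have "p * q = (\<Sum>a\<in>?k p. \<Sum>b\<in>?k q. Poly_Mapping.single (a + b) (?l p a * ?l q b))"
    by (subst poly_mapping_as_sum[of p], subst poly_mapping_as_sum[of q])
       (simp add: sum_product mult_single)
  then have "coproduct (p * q) = (\<Sum>a\<in>?k p. \<Sum>b\<in>?k q. scale (?l p a * ?l q b) (g (a + b)))"
    by (simp add: cop linear_ext_sum linear_ext_single)
  also have "\<dots> = (\<Sum>a\<in>?k p. \<Sum>b\<in>?k q. scale (?l p a) (g a) * scale (?l q b) (g b))"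
  proof (intro sum.cong refl)
    fix a b
    have "g (a + b) = g a * g b"
      by (simp add: g_def)
    moreover have "Poly_Mapping.single 0 (c * d) =
        Poly_Mapping.single (0 :: 'a multiset \<times> 'a multiset) c * Poly_Mapping.single 0 d"
      for c d :: complex
      by (simp add: mult_single)
    ultimately show "scale (?l p a * ?l q b) (g (a + b)) =
        scale (?l p a) (g a) * scale (?l q b) (g b)"
      by (simp add: scale_conv_mult mult_ac)
  qed
  also have "\<dots> = coproduct p * coproduct q"
    by (simp add: cop linear_ext_def sum_product)
  finally show ?thesis .
qed

lemma tensor_basis: "tensor (basis a) (basis b) = basis (a, b)"
  by (simp add: tensor_def basis_def linear_ext_single scale_def)

lemma one_eq_basis: "(1 :: 'b::monoid_add \<Rightarrow>\<^sub>0 complex) = basis 0"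
  by (simp add: basis_def)

lemma coproduct_one: "coproduct 1 = tensor 1 1"
proof -
  have "coproduct (basis {#} :: 'a symalg) = 1"
    unfolding coproduct_def basis_def linear_ext_single by (simp add: scale_def mult_map_scale_conv_mult)
  then show ?thesis
    by (simp add: one_eq_basis tensor_basis zero_prod_def)
qed

lemma coproduct_field_op:
  "coproduct (field_op x) = tensor (field_op x) 1 + tensor 1 (field_op x)"
proof -
  have "coproduct (Poly_Mapping.single {#x#} 1) = tensor (field_op x) 1 + tensor 1 (field_op x)"
    unfolding coproduct_def linear_ext_single by (simp add: scale_def mult_map_scale_conv_mult)
  then show ?thesis
    by (simp add: field_op_def basis_def)
qed

section \<open>Finitely many labels\<close>

lemma inverse_propagator_finite:
  fixes GF K :: "'x::finite \<Rightarrow> 'x \<Rightarrow> complex"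
  assumes "\<And>x y. K x y = K y x"
    and inv: "\<And>x z. (\<Sum>y\<in>UNIV. GF x y * K y z) = (if x = z then 1 else 0)"
  shows "inverse_propagator GF (\<lambda>f. \<Sum>x\<in>UNIV. \<Sum>y\<in>UNIV. K x y * f (x, y))"
  unfolding inverse_propagator_def formal_integral_def
proof (intro conjI allI)
  fix f :: "'x \<times> 'x \<Rightarrow> complex"
  show "(\<Sum>x\<in>UNIV. \<Sum>y\<in>UNIV. K x y * (case (x, y) of (x, y) \<Rightarrow> f (y, x))) =
      (\<Sum>x\<in>UNIV. \<Sum>y\<in>UNIV. K x y * f (x, y))"
    using assms(1) by (subst sum.swap) simp
next
  fix x and h :: "'x \<Rightarrow> complex"
  have "(\<Sum>y\<in>UNIV. \<Sum>z\<in>UNIV. K y z * (GF x y * h z)) =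
      (\<Sum>z\<in>UNIV. (\<Sum>y\<in>UNIV. GF x y * K y z) * h z)"
    by (subst sum.swap) (simp add: sum_distrib_left sum_distrib_right mult_ac)
  also have "\<dots> = h x"
    by (simp add: inv if_distrib[of "\<lambda>c. c * _"] cong: if_cong)
  finally show "(\<Sum>y\<in>UNIV. \<Sum>z\<in>UNIV. K y z * (case (y, z) of (y, z) \<Rightarrow> GF x y * h z)) = h x"
    by simp
qed (simp_all add: distrib_left sum.distrib sum_distrib_left mult_ac)

end

theory Submission
  imports Defs
begin

text \<open>
  The sum \<open>D = \<Sum>\<^sub>i Q\<^sub>i\<close> over all tensor factors is a derivation for concatenation of tensors, and
  \<open>\<Lambda>\<^sup>k = D\<^sup>k / k!\<close>, while \<open>\<tau>\<^bsup>\<otimes>k\<^esup>\<close> is multiplicative.  So \<open>\<tau>\<^bsup>\<otimes>\<bullet>\<^esup> \<circ> D\<^sup>n / n!\<close> satisfies the Leibniz rule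
  on \<open>u \<otimes> v\<close>, and the recursion results from splitting off the first \<open>D\<close>, which is \<open>Q\<close> on a single
  factor.  Only the linearity of the formal integral is available, hence no Fubini theorem; but the
  integral over the first pair of variables is the outermost one, and once that pair is fixed the
  Leibniz rule merely pulls constants out of the remaining integrals.
\<close>

section \<open>Linear forms and linear maps\<close>

lemma lookup_scale [simp]: "Poly_Mapping.lookup (scale c p) b = c * Poly_Mapping.lookup p b"
  by (simp add: scale_def map.rep_eq when_def)

lemma scale_add_right: "scale c (p + q) = scale c p + scale c q"
  by (rule poly_mapping_eqI) (simp add: lookup_add algebra_simps)

lemma scale_0_right [simp]: "scale c 0 = 0"
  by (rule poly_mapping_eqI) simp

lemma scale_1 [simp]: "scale 1 p = p"
  by (rule poly_mapping_eqI) simp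

lemma scale_sum: "scale c (sum f A) = (\<Sum>a\<in>A. scale c (f a))"
  by (induction A rule: infinite_finite_induct) (simp_all add: scale_add_right)

lemma scale_mult: "scale c (p * q) = p * scale c (q :: 'b::comm_monoid_add \<Rightarrow>\<^sub>0 complex)"
  by (simp add: scale_conv_mult mult_ac)

lemma keys_scale: "Poly_Mapping.keys (scale c p) \<subseteq> Poly_Mapping.keys p"
  by (auto simp: in_keys_iff)

lemma linear_ext_basis [simp]: "linear_ext g (basis b) = g b"
  by (simp add: basis_def linear_ext_single)

lemma linear_ext_scale: "linear_ext g (scale c p) = scale c (linear_ext g p)"
  by (simp add: linear_ext_superset[OF finite_keys keys_scale] linear_ext_def[of g p]
      scale_sum scale_scale)

lemma keys_linear_ext:
  "Poly_Mapping.keys (linear_ext g p) \<subseteq> (\<Union>b\<in>Poly_Mapping.keys p. Poly_Mapping.keys (g b))"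
  unfolding linear_ext_def using keys_sum keys_scale by fastforce

lemma linear_form_superset:
  assumes "finite A" "Poly_Mapping.keys p \<subseteq> A"
  shows "linear_form g p = (\<Sum>b\<in>A. Poly_Mapping.lookup p b * g b)"
  unfolding linear_form_def using assms
  by (intro sum.mono_neutral_left) (auto simp: in_keys_iff)

lemma linear_form_0 [simp]: "linear_form g 0 = 0"
  by (simp add: linear_form_def)

lemma linear_form_basis [simp]: "linear_form g (basis b) = g b"
  by (simp add: linear_form_superset[of "{b}"] basis_def)

lemma linear_form_add: "linear_form g (p + q) = linear_form g p + linear_form g q"
proof -
  let ?A = "Poly_Mapping.keys p \<union> Poly_Mapping.keys q"
  have "linear_form g (p + q) = (\<Sum>b\<in>?A. Poly_Mapping.lookup (p + q) b * g b)"
    by (intro linear_form_superset) (auto simp: keys_add)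
  also have "\<dots> = linear_form g p + linear_form g q"
    by (simp add: linear_form_superset[of ?A] lookup_add distrib_right sum.distrib)
  finally show ?thesis .
qed

lemma linear_form_sum: "linear_form g (sum f A) = (\<Sum>a\<in>A. linear_form g (f a))"
  by (induction A rule: infinite_finite_induct) (simp_all add: linear_form_add)

lemma linear_form_scale: "linear_form g (scale c p) = c * linear_form g p"
  by (simp add: linear_form_superset[OF finite_keys keys_scale] linear_form_def[of g p]
      sum_distrib_left mult_ac)

lemma linear_form_linear_ext:
  "linear_form f (linear_ext g p) = linear_form (\<lambda>b. linear_form f (g b)) p"
  by (simp add: linear_ext_def linear_form_sum linear_form_scale linear_form_def[of _ p])

lemma linear_form_cong:
  "(\<And>b. b \<in> Poly_Mapping.keys p \<Longrightarrow> f b = g b) \<Longrightarrow> linear_form f p = linear_form g p"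
  by (simp add: linear_form_def)

lemma linear_form_mult_left: "linear_form (\<lambda>b. c * f b) p = c * linear_form f p"
  unfolding linear_form_def sum_distrib_left by (simp only: mult.left_commute)

lemma linear_form_mult_right: "linear_form (\<lambda>b. f b * c) p = linear_form f p * c"
  unfolding linear_form_def sum_distrib_right by (simp only: mult.assoc)

lemma linear_form_sum_left: "linear_form (\<lambda>b. \<Sum>a\<in>A. f a b) p = (\<Sum>a\<in>A. linear_form (f a) p)"
  by (simp add: linear_form_def sum_distrib_left) (rule sum.swap)

section \<open>\<open>Q\<close> as a linear map with values in two-factor tensors\<close>

lemma Q_linear_ext: "Q p s = linear_ext (\<lambda>m. Q p (basis m)) s"
proof -
  have cop: "coproduct s = linear_ext (\<lambda>m. coproduct (basis m)) s"
    by (simp add: coproduct_def)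
  show ?thesis
    by (simp only: Q_def cop linear_ext_def[of _ s])
       (simp add: sum_distrib_left scale_mult[symmetric] scale_sum linear_ext_sum linear_ext_scale
         scale_scale mult_ac)
qed

lemma keys_Q: "ns \<in> Poly_Mapping.keys (Q p s) \<Longrightarrow> length ns = 2"
  unfolding Q_def by (drule subsetD[OF keys_linear_ext]) (auto simp: basis_def split: prod.splits)

lemma tensor_form_pair_Q:
  "tensor_form [f, g] (Q p s) = linear_form (\<lambda>ns. f (basis (ns ! 0)) * g (basis (ns ! 1))) (Q p s)"
  unfolding tensor_form_def
proof (rule linear_form_cong)
  fix ns assume "ns \<in> Poly_Mapping.keys (Q p s)"
  then have "length ns = 2"
    by (rule keys_Q)
  then obtain a b where "ns = [a, b]"
    by (auto simp: length_Suc_conv numeral_2_eq_2)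
  then show "(if length ns = length [f, g] then prod_list (map2 (\<lambda>f m. f (basis m)) [f, g] ns) else 0)
      = f (basis (ns ! 0)) * g (basis (ns ! 1))"
    by simp
qed

section \<open>Formal integrals\<close>

lemma formal_integral_add: "formal_integral J \<Longrightarrow> J (\<lambda>p. f p + g p) = J f + J g"
  by (simp add: formal_integral_def)

lemma formal_integral_mult: "formal_integral J \<Longrightarrow> J (\<lambda>p. c * f p) = c * J f"
  by (simp add: formal_integral_def)

lemma formal_integral_mult_right: "formal_integral J \<Longrightarrow> J (\<lambda>p. f p * c) = J f * c"
  using formal_integral_mult[of J c f] by (simp add: mult.commute)

lemma formal_integral_0: "formal_integral J \<Longrightarrow> J (\<lambda>p. 0) = 0"
  using formal_integral_mult[of J 0 "\<lambda>_. 0"] by simp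

lemma formal_integral_sum:
  assumes J: "formal_integral J"
  shows "J (\<lambda>p. \<Sum>a\<in>A. f a p) = (\<Sum>a\<in>A. J (f a))"
  by (induction A rule: infinite_finite_induct)
     (simp_all add: formal_integral_0[OF J] formal_integral_add[OF J])

text \<open>As \<open>t\<close> does not depend on the integration variables, its form is a finite
  sum with constant coefficients, and linearity of \<open>J\<close> allows the exchange.\<close>

lemma formal_integral_linear_form:
  assumes J: "formal_integral J"
  shows "J (\<lambda>p. linear_form (f p) t) = linear_form (\<lambda>b. J (\<lambda>p. f p b)) t"
  by (simp add: linear_form_def formal_integral_sum[OF J] formal_integral_mult[OF J])

lemma iterated_integral_cong:
  "(\<And>ps. length ps = n \<Longrightarrow> f ps = g ps) \<Longrightarrow> iterated_integral J n f = iterated_integral J n g"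
proof (induction n arbitrary: f g)
  case (Suc n)
  have "iterated_integral J n (\<lambda>ps. f (p # ps)) = iterated_integral J n (\<lambda>ps. g (p # ps))" for p
    by (rule Suc.IH) (simp add: Suc.prems)
  then show ?case by simp
qed simp

lemma iterated_integral_mult:
  assumes J: "formal_integral J"
  shows "iterated_integral J n (\<lambda>ps. c * f ps) = c * iterated_integral J n f"
  by (induction n arbitrary: f) (simp_all add: formal_integral_mult[OF J])

section \<open>The derivation extending \<open>Q\<close>\<close>

text \<open>The range of \<open>i\<close> follows the length of each basis tensor, so a single
  operator acts on all tensor powers at once and can be iterated.\<close>

definition Q_total :: "'x \<times> 'x \<Rightarrow> 'x tensors \<Rightarrow> 'x tensors" where
  "Q_total p = linear_ext (\<lambda>ms. \<Sum>i=1..length ms. Q_at i p (basis ms))"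

lemma Q_total_scale: "Q_total p (scale c t) = scale c (Q_total p t)"
  by (simp add: Q_total_def linear_ext_scale)

lemma linear_form_Q_at_basis:
  "linear_form f (Q_at i p (basis ms)) =
     linear_form (\<lambda>ns. f (take (i - 1) ms @ ns @ drop i ms)) (Q p (basis (ms ! (i - 1))))"
  by (simp add: Q_at_def linear_form_linear_ext)

text \<open>The derivation property: each \<open>Q_at i\<close> changes one factor, lying either in
  \<open>u\<close> or in \<open>v\<close>. Testing against an arbitrary \<open>f\<close> avoids
  introducing a concatenation product on tensors.\<close>

lemma linear_form_Q_total_append:
  fixes u v :: "'x multiset list"
  shows "linear_form f (Q_total p (basis (u @ v))) =
     linear_form (\<lambda>w. f (w @ v)) (Q_total p (basis u)) + linear_form (\<lambda>w. f (u @ w)) (Q_total p (basis v))"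
proof -
  \<comment> \<open>The contribution of the factor at position \<open>i\<close>, now counted from
    0.\<close>
  define h where "h ms i = linear_form (\<lambda>ns. f (take i ms @ ns @ drop (Suc i) ms)) (Q p (basis (ms ! i)))"
    for ms :: "'x multiset list" and i
  have expand: "linear_form g (Q_total p (basis ms)) =
      (\<Sum>i<length ms. linear_form (\<lambda>ns. g (take i ms @ ns @ drop (Suc i) ms)) (Q p (basis (ms ! i))))"
    for g and ms :: "'x multiset list"
    unfolding Q_total_def linear_ext_basis linear_form_sum linear_form_Q_at_basis
    by (rule sum.reindex_bij_witness[of _ Suc "\<lambda>i. i - 1"]) auto
  have "(\<Sum>i<length (u @ v). h (u @ v) i) =
      (\<Sum>i<length u. h (u @ v) i) + (\<Sum>i<length v. h (u @ v) (i + length u))"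
    by (simp add: lessThan_atLeast0 sum.atLeastLessThan_concat[of 0 "length u" "length u + length v", symmetric]
        sum.shift_bounds_nat_ivl[of _ 0 "length u" "length v", simplified, symmetric] add.commute)
  also have "(\<Sum>i<length u. h (u @ v) i) = linear_form (\<lambda>w. f (w @ v)) (Q_total p (basis u))"
    unfolding expand by (intro sum.cong) (auto simp: h_def nth_append)
  also have "(\<Sum>i<length v. h (u @ v) (i + length u)) = linear_form (\<lambda>w. f (u @ w)) (Q_total p (basis v))"
    unfolding expand by (intro sum.cong) (auto simp: h_def nth_append)
  finally show ?thesis
    by (simp add: expand h_def)
qed

text \<open>The result has \<open>i - 1\<close> old factors, two new ones and \<open>n - i\<close>
  old ones; the bounds on \<open>i\<close> make this count valid.\<close>

lemma keys_Q_at: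
  assumes "\<And>ms. ms \<in> Poly_Mapping.keys t \<Longrightarrow> length ms = n" and "1 \<le> i" "i \<le> n"
    and "ks \<in> Poly_Mapping.keys (Q_at i p t)"
  shows "length ks = Suc n"
  using assms(4) unfolding Q_at_def
  by (auto dest!: subsetD[OF keys_linear_ext] keys_Q assms(1) simp: basis_def)
     (use assms(2,3) in auto)

lemma Q_at_sum_eq_Q_total:
  assumes "\<And>ms. ms \<in> Poly_Mapping.keys t \<Longrightarrow> length ms = n"
  shows "(\<Sum>i=1..n. Q_at i p t) = Q_total p t"
proof -
  have "Q_at i p t = linear_ext (\<lambda>ms. Q_at i p (basis ms)) t" for i
    by (simp add: Q_at_def)
  then have "(\<Sum>i=1..n. Q_at i p t) = linear_ext (\<lambda>ms. \<Sum>i=1..n. Q_at i p (basis ms)) t"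
    by (simp add: linear_ext_def scale_sum) (rule sum.swap)
  also have "\<dots> = Q_total p t"
    using assms by (simp add: Q_total_def linear_ext_def)
  finally show ?thesis .
qed

section \<open>\<open>Lambda\<close> as a divided power of the derivation\<close>

lemma keys_Lambda: "ms \<in> Poly_Mapping.keys (Lambda k ps s) \<Longrightarrow> length ms = Suc k"
proof (induction k arbitrary: ps ms)
  case 0
  then show ?case
    by (auto dest!: subsetD[OF keys_linear_ext] simp: basis_def)
next
  case (Suc k)
  have "ms \<in> Poly_Mapping.keys (\<Sum>i=1..Suc k. Q_at i (ps ! k) (Lambda k (take k ps) s))"
    by (rule subsetD[OF keys_scale]) (rule Suc.prems[unfolded Lambda.simps])
  then have "ms \<in> (\<Union>i\<in>{1..Suc k}. Poly_Mapping.keys (Q_at i (ps ! k) (Lambda k (take k ps) s)))"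
    by (rule subsetD[OF keys_sum])
  then obtain i where i: "i \<in> {1..Suc k}"
    "ms \<in> Poly_Mapping.keys (Q_at i (ps ! k) (Lambda k (take k ps) s))"
    by (rule UN_E)
  show ?case
    by (rule keys_Q_at[OF Suc.IH _ _ i(2)]) (use i(1) in auto)
qed

text \<open>The factors \<open>1 / of_nat (Suc k)\<close> accumulate to an inverse factorial.
  \<open>fold\<close> applies the head of \<open>ps\<close> first, in agreement with
  \<open>Lambda\<close> using the last pair last.\<close>

lemma Lambda_eq_fold_Q_total:
  "length ps = k \<Longrightarrow>
     Lambda k ps s = scale (1 / fact k) (fold Q_total ps (linear_ext (\<lambda>m. basis [m]) s))"
proof (induction k arbitrary: ps)
  case (Suc k)
  let ?t = "linear_ext (\<lambda>m. basis [m]) s"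
  have snoc: "take k ps @ [ps ! k] = ps"
    using Suc.prems by (simp flip: take_Suc_conv_app_nth)
  have last: "Q_total (ps ! k) (fold Q_total (take k ps) ?t) = fold Q_total (take k ps @ [ps ! k]) ?t"
    by simp
  have "Lambda (Suc k) ps s = scale (1 / of_nat (Suc k)) (Q_total (ps ! k) (Lambda k (take k ps) s))"
    by (simp only: Lambda.simps Q_at_sum_eq_Q_total[OF keys_Lambda])
  also have "\<dots> = scale (1 / fact (Suc k)) (Q_total (ps ! k) (fold Q_total (take k ps) ?t))"
    using Suc by (simp add: Q_total_scale scale_scale)
  also have "\<dots> = scale (1 / fact (Suc k)) (fold Q_total ps ?t)"
    by (simp only: last snoc)
  finally show ?case .
qed simp

section \<open>The forms on all tensor powers\<close>

context
  fixes J :: "('x \<times> 'x \<Rightarrow> complex) \<Rightarrow> complex" and \<tau> :: "'x symalg \<Rightarrow> complex"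
begin

text \<open>\<open>sigma_tensor n\<close> is \<open>\<tau>\<^bsup>\<otimes>(n+k)\<^esup> \<circ> (\<Sum>\<^sub>i Q\<^sub>i)\<^sup>n / n!\<close> on the basis of \<open>S(V)\<^bsup>\<otimes>k\<^esup>\<close>, for all \<open>k\<close>.\<close>

fun sigma_tensor :: "nat \<Rightarrow> 'x multiset list \<Rightarrow> complex" where
  "sigma_tensor 0 ms = prod_list (map (\<lambda>m. \<tau> (basis m)) ms)"
| "sigma_tensor (Suc n) ms =
     J (\<lambda>p. linear_form (sigma_tensor n) (Q_total p (basis ms))) / of_nat (Suc n)"

text \<open>The head of the list is both the outermost integration variable and the argument of the
  first \<open>Q_total\<close>, so induction with \<open>t\<close> arbitrary peels off both
  together.\<close>

lemma iterated_integral_fold_Q_total: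
  assumes J: "formal_integral J"
  shows "iterated_integral J n (\<lambda>ps. linear_form (sigma_tensor 0) (fold Q_total ps t)) =
    fact n * linear_form (sigma_tensor n) t"
proof (induction n arbitrary: t)
  case (Suc n)
  have "iterated_integral J (Suc n) (\<lambda>ps. linear_form (sigma_tensor 0) (fold Q_total ps t)) =
      J (\<lambda>p. fact n * linear_form (sigma_tensor n) (Q_total p t))"
    by (simp only: iterated_integral.simps fold_simps Suc.IH)
  also have "\<dots> = fact n * linear_form (\<lambda>ms. of_nat (Suc n) * sigma_tensor (Suc n) ms) t"
    by (simp add: Q_total_def linear_form_linear_ext formal_integral_linear_form[OF J]
        formal_integral_mult[OF J] del: of_nat_Suc)
  also have "\<dots> = fact (Suc n) * linear_form (sigma_tensor (Suc n)) t"
    by (simp only: linear_form_mult_left) (simp del: sigma_tensor.simps)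
  finally show ?case .
qed simp

text \<open>The inverse factorial in \<open>Lambda\<close> cancels the factorial produced by the
  iterated integral.\<close>

lemma sigma_T_eq:
  assumes J: "formal_integral J"
  shows "sigma_T J \<tau> (Suc n) s = linear_form (\<lambda>m. sigma_tensor n [m]) s"
proof -
  let ?t = "linear_ext (\<lambda>m. basis [m]) s"
  have *: "tensor_form (replicate (Suc n) \<tau>) (Lambda n ps s) =
      1 / fact n * linear_form (sigma_tensor 0) (fold Q_total ps ?t)" if "length ps = n" for ps
  proof -
    have prod: "prod_list (map2 (\<lambda>f m. f (basis m)) (replicate k \<tau>) ms) = sigma_tensor 0 ms"
      if "length ms = k" for k and ms :: "'x multiset list"
      using that by (induction ms arbitrary: k) auto
    have "tensor_form (replicate (Suc n) \<tau>) (Lambda n ps s) =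
        linear_form (sigma_tensor 0) (Lambda n ps s)"
      unfolding tensor_form_def
      by (intro linear_form_cong) (simp add: keys_Lambda prod del: replicate_Suc sigma_tensor.simps)
    then show ?thesis
      by (simp only: Lambda_eq_fold_Q_total[OF that] linear_form_scale)
  qed
  have "sigma_T J \<tau> (Suc n) s =
      iterated_integral J n (\<lambda>ps. 1 / fact n * linear_form (sigma_tensor 0) (fold Q_total ps ?t))"
    unfolding sigma_T_def comp_Lambda_def diff_Suc_1 by (rule iterated_integral_cong) (rule *)
  also have "\<dots> = linear_form (sigma_tensor n) ?t"
    by (simp only: iterated_integral_mult[OF J] iterated_integral_fold_Q_total[OF J]) simp
  finally show ?thesis
    by (simp add: linear_form_linear_ext)
qed

text \<open>The Leibniz rule for divided powers, which has no binomial coefficients. The first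
  derivation acts on \<open>u\<close> or on \<open>v\<close>, and the induction hypothesis splits
  the rest.\<close>

lemma sigma_tensor_append:
  assumes J: "formal_integral J"
  shows "sigma_tensor n (u @ v) = (\<Sum>j\<le>n. sigma_tensor j u * sigma_tensor (n - j) v)"
proof (induction n arbitrary: u v)
  case (Suc n)
  let ?g = sigma_tensor
  have step: "J (\<lambda>p. linear_form (?g m) (Q_total p (basis w))) = of_nat (Suc m) * ?g (Suc m) w" for m w
    by (simp del: of_nat_Suc)
  have "of_nat (Suc n) * ?g (Suc n) (u @ v) =
      J (\<lambda>p. linear_form (\<lambda>w. ?g n (w @ v)) (Q_total p (basis u)) +
             linear_form (\<lambda>w. ?g n (u @ w)) (Q_total p (basis v)))"
    by (simp only: step[symmetric] linear_form_Q_total_append)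
  \<comment> \<open>With the outer pair \<open>p\<close> fixed, the value on the untouched side is a
    constant and leaves both the form and the integral.\<close>
  also have "\<dots> =
      (\<Sum>j\<le>n. of_nat (Suc j) * ?g (Suc j) u * ?g (n - j) v) +
      (\<Sum>j\<le>n. ?g j u * (of_nat (Suc (n - j)) * ?g (Suc (n - j)) v))"
    by (simp only: Suc.IH linear_form_sum_left linear_form_mult_left linear_form_mult_right
        formal_integral_add[OF J] formal_integral_sum[OF J] formal_integral_mult[OF J]
        formal_integral_mult_right[OF J] step)
  \<comment> \<open>The extra summand \<open>j = 0\<close> has weight 0; below, so does
    \<open>j = Suc n\<close>.\<close>
  also have "(\<Sum>j\<le>n. of_nat (Suc j) * ?g (Suc j) u * ?g (n - j) v) =
      (\<Sum>j\<le>Suc n. of_nat j * ?g j u * ?g (Suc n - j) v)"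
    by (subst sum.atMost_Suc_shift) simp
  also have "(\<Sum>j\<le>n. ?g j u * (of_nat (Suc (n - j)) * ?g (Suc (n - j)) v)) =
      (\<Sum>j\<le>Suc n. of_nat (Suc n - j) * ?g j u * ?g (Suc n - j) v)"
    by (auto intro!: sum.cong simp: Suc_diff_le simp del: of_nat_Suc of_nat_diff sigma_tensor.simps)
  \<comment> \<open>The weights \<open>j\<close> and \<open>Suc n - j\<close> add up to
    \<open>Suc n\<close>, the denominator in \<open>sigma_tensor (Suc n)\<close>.\<close>
  also have "(\<Sum>j\<le>Suc n. of_nat j * ?g j u * ?g (Suc n - j) v) + \<dots> =
      of_nat (Suc n) * (\<Sum>j\<le>Suc n. ?g j u * ?g (Suc n - j) v)"
    unfolding sum.distrib[symmetric] sum_distrib_left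
    by (intro sum.cong refl)
       (simp add: algebra_simps del: sigma_tensor.simps)
  finally show ?case
    by (simp del: of_nat_Suc sum.atMost_Suc sigma_tensor.simps)
qed simp

text \<open>The first derivation meets a single factor and is \<open>Q\<close> itself; the remaining
  \<open>k - 2\<close> act on its two factors and are distributed by the Leibniz rule.\<close>

lemma sigma_T_recursion:
  assumes J: "formal_integral J" and k: "k > 1"
  shows "sigma_T J \<tau> k s = 1 / of_nat (k - 1) *
    (\<Sum>i=1..k-1. comp_Q J (tensor_form [sigma_T J \<tau> i, sigma_T J \<tau> (k - i)]) s)"
proof -
  obtain n where n: "k = Suc (Suc n)"
    using less_imp_Suc_add[OF k] by auto
  have single: "Q_total p (basis [m]) = Q p (basis m)" for p and m :: "'x multiset"
  proof -
    \<comment> \<open>On one factor \<open>Q_at 1\<close> has nothing to keep on either side, so it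
      merely re-expands \<open>Q p (basis m)\<close> in the basis.\<close>
    have "linear_ext basis t = t" for t :: "'x tensors"
      using poly_mapping_as_sum[of t] by (simp add: linear_ext_def scale_def basis_def)
    then show ?thesis
      by (simp add: Q_total_def Q_at_def)
  qed
  have pair: "sigma_tensor n ns =
      (\<Sum>j\<le>n. sigma_T J \<tau> (Suc j) (basis (ns ! 0)) * sigma_T J \<tau> (Suc (n - j)) (basis (ns ! 1)))"
    if len: "length ns = 2" for ns :: "'x multiset list"
  proof -
    obtain a b where "ns = [a, b]"
      using len by (auto simp: length_Suc_conv numeral_2_eq_2)
    then have "ns = [a] @ [b]"
      by simp
    then show ?thesis
      by (simp only: sigma_tensor_append[OF J] sigma_T_eq[OF J]) simp
  qed
  have leib: "linear_form (sigma_tensor n) (Q p s) =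
      (\<Sum>j\<le>n. tensor_form [sigma_T J \<tau> (Suc j), sigma_T J \<tau> (Suc (n - j))] (Q p s))" for p
    unfolding tensor_form_pair_Q linear_form_sum_left[symmetric]
    by (rule linear_form_cong, rule pair, erule keys_Q)
  have "sigma_T J \<tau> k s =
      1 / of_nat (Suc n) * linear_form (\<lambda>m. J (\<lambda>p. linear_form (sigma_tensor n) (Q p (basis m)))) s"
    unfolding n sigma_T_eq[OF J] linear_form_mult_left[symmetric] by (simp add: single)
  also have "\<dots> = 1 / of_nat (Suc n) * J (\<lambda>p. linear_form (sigma_tensor n) (Q p s))"
    by (simp only: Q_linear_ext[of _ s] linear_form_linear_ext formal_integral_linear_form[OF J])
  also have "J (\<lambda>p. linear_form (sigma_tensor n) (Q p s)) =
      (\<Sum>j\<le>n. comp_Q J (tensor_form [sigma_T J \<tau> (Suc j), sigma_T J \<tau> (Suc (n - j))]) s)"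
    by (simp only: leib formal_integral_sum[OF J] comp_Q_def)
  \<comment> \<open>The substitution is \<open>i = Suc j\<close>, so
    \<open>k - i = Suc (n - j)\<close>.\<close>
  also have "\<dots> = (\<Sum>i=1..k-1. comp_Q J (tensor_form [sigma_T J \<tau> i, sigma_T J \<tau> (k - i)]) s)"
    by (rule sum.reindex_bij_witness[of _ "\<lambda>i. i - 1" Suc]) (auto simp: n Suc_diff_le)
  finally show ?thesis
    by (simp add: n)
qed

end

text \<open>The last conjunct expresses "determined": every solution of the recursion agrees with
  \<sigma> from index 1 on.\<close>

theorem corollary19:
  fixes GF :: "'x \<Rightarrow> 'x \<Rightarrow> complex"
    and Ginv :: "('x \<times> 'x \<Rightarrow> complex) \<Rightarrow> complex"
    and vert :: "('x \<Rightarrow> complex) multiset \<Rightarrow> complex"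
    and \<tau> :: "'x symalg \<Rightarrow> complex"
    and \<sigma> :: "nat \<Rightarrow> 'x symalg \<Rightarrow> complex"
  assumes "\<And>x y. GF x y = GF y x"
    and "inverse_propagator GF Ginv"
    and "interaction_vertices vert"
    and "\<tau> = tau_T GF vert"
    and "\<And>k. k \<ge> 1 \<Longrightarrow> \<sigma> k = sigma_T Ginv \<tau> k"
  shows "\<sigma> 1 = \<tau> \<and>
    (\<forall>k>1. \<forall>s. \<sigma> k s = 1 / of_nat (k - 1) *
       (\<Sum>i=1..k-1. comp_Q Ginv (tensor_form [\<sigma> i, \<sigma> (k - i)]) s)) \<and>
    (\<forall>\<rho>. \<rho> 1 = \<tau> \<and>
       (\<forall>k>1. \<forall>s. \<rho> k s = 1 / of_nat (k - 1) *
          (\<Sum>i=1..k-1. comp_Q Ginv (tensor_form [\<rho> i, \<rho> (k - i)]) s)) \<longrightarrow>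
       (\<forall>k\<ge>1. \<rho> k = \<sigma> k))"
proof (intro conjI allI impI)
  have J: "formal_integral Ginv"
    using assms(2) by (simp add: inverse_propagator_def)
  show one: "\<sigma> 1 = \<tau>"
  proof
    fix s
    have "\<sigma> 1 s = linear_form (\<lambda>m. \<tau> (basis m)) s"
      using assms(5)[of 1] sigma_T_eq[OF J, of \<tau> 0 s] by simp
    \<comment> \<open>\<open>tau_T\<close> is a linear form, hence recovered from its values on
      monomials.\<close>
    also have "\<dots> = \<tau> s"
      by (simp add: assms(4) tau_T_def)
    finally show "\<sigma> 1 s = \<tau> s" .
  qed
  show rec: "\<sigma> k s = 1 / of_nat (k - 1) *
      (\<Sum>i=1..k-1. comp_Q Ginv (tensor_form [\<sigma> i, \<sigma> (k - i)]) s)" if "k > 1" for k s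
  proof -
    have "(\<Sum>i=1..k-1. comp_Q Ginv (tensor_form [sigma_T Ginv \<tau> i, sigma_T Ginv \<tau> (k - i)]) s) =
        (\<Sum>i=1..k-1. comp_Q Ginv (tensor_form [\<sigma> i, \<sigma> (k - i)]) s)"
    proof (intro sum.cong refl)
      fix i assume "i \<in> {1..k-1}"
      then have "1 \<le> i" "1 \<le> k - i"
        using that by auto
      then show "comp_Q Ginv (tensor_form [sigma_T Ginv \<tau> i, sigma_T Ginv \<tau> (k - i)]) s =
          comp_Q Ginv (tensor_form [\<sigma> i, \<sigma> (k - i)]) s"
        by (simp only: assms(5))
    qed
    then show ?thesis
      using sigma_T_recursion[OF J that, of \<tau> s] that by (simp add: assms(5))
  qed
  fix \<rho> :: "nat \<Rightarrow> 'x symalg \<Rightarrow> complex" and k :: nat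
  assume \<rho>: "\<rho> 1 = \<tau> \<and> (\<forall>k>1. \<forall>s. \<rho> k s = 1 / of_nat (k - 1) *
      (\<Sum>i=1..k-1. comp_Q Ginv (tensor_form [\<rho> i, \<rho> (k - i)]) s))"
  assume "k \<ge> 1"
  then show "\<rho> k = \<sigma> k"
  \<comment> \<open>Both indices \<open>i\<close> and \<open>k - i\<close> lie between 1 and
    \<open>k - 1\<close>, so the recursion refers to smaller positive indices only.\<close>
  proof (induction k rule: less_induct)
    case (less k)
    show ?case
    proof (cases "k = 1")
      case False
      with less.prems have "k > 1" by simp
      moreover have "(\<Sum>i=1..k-1. comp_Q Ginv (tensor_form [\<rho> i, \<rho> (k - i)]) s) =
          (\<Sum>i=1..k-1. comp_Q Ginv (tensor_form [\<sigma> i, \<sigma> (k - i)]) s)" for s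
      proof (intro sum.cong refl)
        fix i assume "i \<in> {1..k-1}"
        then have "1 \<le> i" "i < k" "1 \<le> k - i" "k - i < k"
          using \<open>k > 1\<close> by auto
        then show "comp_Q Ginv (tensor_form [\<rho> i, \<rho> (k - i)]) s =
            comp_Q Ginv (tensor_form [\<sigma> i, \<sigma> (k - i)]) s"
          by (simp only: less.IH)
      qed
      ultimately show ?thesis
        using \<rho> rec by (intro ext) simp
    qed (use \<rho> one in simp)
  qed
qed

end
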